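(* For all integers $n,p\ge0$, \[ x^{p}\mathrm{Bel}_{n,\lambda}^{(p)}(x)=\sum_{m=0}^{n+p}\frac{\binom{n+p}{m}}{\binom{n+p}{n}}\beta_{n+p-m,\lambda}^{(p)}\mathrm{Bel}_{m,\lambda}(x)-\sum_{k=1}^{p}\frac{\binom{p}{k}}{\binom{n+k}{n}}\beta_{n+k,\lambda}^{(k)}x^{p-k}, \] and in particular (taking $x=1$) \[ \mathrm{Bel}_{n,\lambda}^{(p)}=\sum_{m=0}^{n+p}\frac{\binom{n+p}{m}}{\binom{n+p}{n}}\beta_{n+p-m,\lambda}^{(p)}\mathrm{Bel}_{m,\lambda}-\sum_{k=1}^{p}\frac{\binom{p}{k}}{\binom{n+k}{n}}\beta_{n+k,\lambda}^{(k)}. \]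
   Context: Let $\lambda\in\mathbb{R}$. Set $(x)_{0,\lambda}=1$, $(x)_{n,\lambda}=x(x-\lambda)\cdots(x-(n-1)\lambda)$ for $n\ge1$. The degenerate exponential is the formal power series $e_\lambda^x(t)=\sum_{n\ge0}(x)_{n,\lambda}\frac{t^n}{n!}$ ($=(1+\lambda t)^{x/\lambda}$, and $e^{xt}$ if $\lambda=0$), $e_\lambda(t)=e_\lambda^1(t)$. Degenerate Bell polynomials: $e^{x(e_\lambda(t)-1)}=\sum_{n\ge0}\mathrm{Bel}_{n,\lambda}(x)\frac{t^n}{n!}$, $\mathrm{Bel}_{n,\lambda}=\mathrm{Bel}_{n,\lambda}(1)$. For an integer $r\ge1$, the degenerate Bernoulli numbers of order $r$ are given by $\big(\frac{t}{e_\lambda(t)-1}\big)^r=\sum_{n\ge0}\beta^{(r)}_{n,\lambda}\frac{t^n}{n!}$, with $\beta^{(0)}_{n,\lambda}=\delta_{n,0}$. For an integer $p\ge0$, the truncated degenerate Bell polynomials are defined by $\sum_{n\ge0}\mathrm{Bel}^{(p)}_{n,\lambda}(x)\frac{t^n}{n!}=\frac{p!}{x^p(e_\lambda(t)-1)^p}\Big(e^{x(e_\lambda(t)-1)}-\sum_{k=0}^{p-1}\frac{x^k(e_\lambda(t)-1)^k}{k!}\Big)=p!\sum_{k\ge0}\frac{x^k(e_\lambda(t)-1)^k}{(k+p)!}$, and $\mathrm{Bel}^{(p)}_{n,\lambda}=\mathrm{Bel}^{(p)}_{n,\lambda}(1)$. *)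

theory Defs
  imports Complex_Main "HOL-Computational_Algebra.Formal_Power_Series"
begin

definition deg_falling :: "real \<Rightarrow> real \<Rightarrow> nat \<Rightarrow> real" where
  "deg_falling lam x n = (\<Prod>i<n. x - of_nat i * lam)"

definition deg_exp_pow :: "real \<Rightarrow> real \<Rightarrow> real fps" where
  "deg_exp_pow lam x = Abs_fps (\<lambda>n. deg_falling lam x n / fact n)"

definition deg_exp :: "real \<Rightarrow> real fps" where
  "deg_exp lam = deg_exp_pow lam 1"

lemma deg_exp_nth_0: "fps_nth (deg_exp lam) 0 = 1"
  by (simp add: deg_exp_def deg_exp_pow_def deg_falling_def)

lemma deg_exp_nth_1: "fps_nth (deg_exp lam) 1 = 1"
  by (simp add: deg_exp_def deg_exp_pow_def deg_falling_def)

text \<open>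
  Bell polynomials are represented by their values at real arguments.  The inner series
  has constant term 0, so the composition is the formal substitution of
  \<^term>\<open>deg_exp lam - 1\<close> for \<open>u\<close> in \<open>exp (x u)\<close>.
\<close>

definition deg_Bell_poly :: "nat \<Rightarrow> real \<Rightarrow> real \<Rightarrow> real" where
  "deg_Bell_poly n lam x = fact n * fps_nth (fps_exp x oo (deg_exp lam - 1)) n"

definition deg_Bell :: "nat \<Rightarrow> real \<Rightarrow> real" where
  "deg_Bell n lam = deg_Bell_poly n lam 1"

text \<open>
  The denominator has subdegree 1, so the division of power series below is exact;
  the case \<open>r = 0\<close> gives the convention that the number is 1 for \<open>n = 0\<close> and 0 otherwise.
\<close>

definition deg_Bernoulli :: "nat \<Rightarrow> nat \<Rightarrow> real \<Rightarrow> real" where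
  "deg_Bernoulli r n lam = fact n * fps_nth ((fps_X / (deg_exp lam - 1)) ^ r) n"

lemma deg_Bernoulli_quotient:
  "(fps_X / (deg_exp lam - 1)) * (deg_exp lam - 1) = (fps_X :: real fps)"
proof -
  let ?u = "deg_exp lam - 1"
  have u1: "fps_nth ?u 1 = 1" using deg_exp_nth_1[of lam] by simp
  hence u: "?u \<noteq> 0" by (metis fps_zero_nth zero_neq_one)
  have "subdegree ?u \<le> 1" using u1 by (intro subdegree_leI) simp
  hence "?u dvd fps_X" using u by (simp add: fps_dvd_iff)
  thus ?thesis by simp
qed

lemma deg_Bernoulli_0: "deg_Bernoulli 0 n lam = (if n = 0 then 1 else 0)"
  by (simp add: deg_Bernoulli_def)

text \<open>
  The truncated polynomials are defined through the series
  \<open>p! * (\<Sum>k. x^k u^k / (k + p)!)\<close> with \<open>u = deg_exp lam - 1\<close>, which also makes sense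
  at \<open>x = 0\<close>.  Lemma \<open>trunc_deg_Bell_gf_quotient\<close> recovers the form with
  \<open>x^p u^p\<close> in the denominator.
\<close>

definition trunc_deg_Bell_gf :: "nat \<Rightarrow> real \<Rightarrow> real \<Rightarrow> real fps" where
  "trunc_deg_Bell_gf p lam x =
     fact p * (Abs_fps (\<lambda>k. x ^ k / fact (k + p)) oo (deg_exp lam - 1))"

definition trunc_deg_Bell_poly :: "nat \<Rightarrow> nat \<Rightarrow> real \<Rightarrow> real \<Rightarrow> real" where
  "trunc_deg_Bell_poly p n lam x = fact n * fps_nth (trunc_deg_Bell_gf p lam x) n"

definition trunc_deg_Bell :: "nat \<Rightarrow> nat \<Rightarrow> real \<Rightarrow> real" where
  "trunc_deg_Bell p n lam = trunc_deg_Bell_poly p n lam 1"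

lemma trunc_deg_Bell_gf_quotient:
  "fps_const x ^ p * (deg_exp lam - 1) ^ p * trunc_deg_Bell_gf p lam x =
     fact p * ((fps_exp x oo (deg_exp lam - 1)) -
       (\<Sum>k<p. fps_const (x ^ k / fact k) * (deg_exp lam - 1) ^ k))"
proof -
  let ?u = "deg_exp lam - 1"
  let ?T = "Abs_fps (\<lambda>k. x ^ k / fact (k + p)) :: real fps"
  have u0: "fps_nth ?u 0 = 0" using deg_exp_nth_0[of lam] by simp
  have *: "fps_const (x ^ p) * fps_X ^ p * ?T =
      fps_exp x - (\<Sum>k<p. fps_const (x ^ k / fact k) * fps_X ^ k)"
  proof (rule fps_ext)
    fix n
    have "fps_nth (\<Sum>k<p. fps_const (x ^ k / fact k) * fps_X ^ k) n =
        (\<Sum>k<p. if k = n then x ^ k / fact k else 0)"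
      unfolding fps_sum_nth by (intro sum.cong) auto
    also have "\<dots> = (if n < p then x ^ n / fact n else 0)"
      by (subst sum.delta) auto
    finally show "fps_nth (fps_const (x ^ p) * fps_X ^ p * ?T) n =
        fps_nth (fps_exp x - (\<Sum>k<p. fps_const (x ^ k / fact k) * fps_X ^ k)) n"
      by (simp add: mult.assoc fps_X_power_mult_nth flip: power_add)
  qed
  have "(fps_const (x ^ p) * fps_X ^ p * ?T) oo ?u = fps_const (x ^ p) * ?u ^ p * (?T oo ?u)"
    using u0 by (simp add: fps_compose_mult_distrib fps_compose_power[symmetric])
  moreover have "(fps_exp x - (\<Sum>k<p. fps_const (x ^ k / fact k) * fps_X ^ k)) oo ?u =
      (fps_exp x oo ?u) - (\<Sum>k<p. fps_const (x ^ k / fact k) * ?u ^ k)"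
    using u0 by (simp add: fps_compose_sub_distrib fps_compose_sum_distrib
        fps_compose_mult_distrib fps_compose_power[symmetric])
  ultimately have eq: "fps_const (x ^ p) * ?u ^ p * (?T oo ?u) =
      (fps_exp x oo ?u) - (\<Sum>k<p. fps_const (x ^ k / fact k) * ?u ^ k)"
    using * by simp
  have "fps_const x ^ p * ?u ^ p * (fact p * (?T oo ?u)) =
      fact p * (fps_const (x ^ p) * ?u ^ p * (?T oo ?u))"
    by (simp only: fps_const_power mult_ac)
  thus ?thesis unfolding trunc_deg_Bell_gf_def eq .
qed

end

theory Submission
  imports Defs
begin

text \<open>
  Write \<open>u = deg_exp lam - 1\<close> and \<open>B = fps_X / u\<close>.  Multiplying the quotient form of the truncated
  generating function \<open>T\<close> by \<open>B ^ p\<close> turns every \<open>u ^ k * B ^ p\<close> into \<open>fps_X ^ k * B ^ (p - k)\<close>, so that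
  \<open>x ^ p * fps_X ^ p * T\<close> is \<open>fact p * B ^ p * (fps_exp x oo u)\<close> minus a polynomial combination
  of powers of \<open>B\<close>.  The claim is the coefficient of \<open>fps_X ^ (n + p)\<close>.
\<close>

lemma trunc_deg_Bell_gf_Bernoulli:
  fixes lam x :: real and p :: nat
  defines "B \<equiv> fps_X / (deg_exp lam - 1)"
  shows "fps_const (x ^ p) * (fps_X ^ p * trunc_deg_Bell_gf p lam x) =
    fps_const (fact p) * ((fps_exp x oo (deg_exp lam - 1)) * B ^ p) -
    (\<Sum>k=1..p. fps_const (fact p * x ^ (p - k) / fact (p - k)) * (fps_X ^ (p - k) * B ^ k))"
proof -
  define u where "u = deg_exp lam - 1"
  have Bu: "B * u = fps_X"
    unfolding B_def u_def by (rule deg_Bernoulli_quotient)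
  \<comment> \<open>On the left, \<open>fact\<close> is taken in the ring of power series; as a
    constant series it merely scales coefficients.\<close>
  have fact_const: "fact p = (fps_const (fact p) :: real fps)"
    using fps_of_nat[where 'a = real, of "fact p"] by simp
  \<comment> \<open>Pairing \<open>j\<close> of the \<open>p\<close> factors \<open>B\<close> with
    the factors \<open>u\<close> uses \<open>B * u = fps_X\<close> and avoids any further division
    of series.\<close>
  have pow: "B ^ p * u ^ j = fps_X ^ j * B ^ (p - j)" if "j \<le> p" for j
  proof -
    have "B ^ p * u ^ j = B ^ (p - j) * (B ^ j * u ^ j)"
      using that by (simp flip: power_add mult.assoc)
    then show ?thesis by (simp add: Bu mult.commute flip: power_mult_distrib)
  qed
  \<comment> \<open>The case \<open>j = p\<close> of \<open>pow\<close>, read backwards, replaces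
    \<open>fps_X ^ p\<close> by \<open>B ^ p * u ^ p\<close>.\<close>
  have "fps_const (x ^ p) * (fps_X ^ p * trunc_deg_Bell_gf p lam x) =
      B ^ p * (fps_const x ^ p * u ^ p * trunc_deg_Bell_gf p lam x)"
    using pow[of p] by (simp add: mult_ac)
  also have "\<dots> = fps_const (fact p) * ((fps_exp x oo u) * B ^ p) -
      fps_const (fact p) * (\<Sum>j<p. fps_const (x ^ j / fact j) * (B ^ p * u ^ j))"
    unfolding u_def trunc_deg_Bell_gf_quotient
    by (simp add: fact_const right_diff_distrib sum_distrib_left mult_ac)
  also have "fps_const (fact p) * (\<Sum>j<p. fps_const (x ^ j / fact j) * (B ^ p * u ^ j)) =
      (\<Sum>j<p. fps_const (fact p * x ^ j / fact j) * (fps_X ^ j * B ^ (p - j)))"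
    by (simp add: sum_distrib_left pow flip: mult.assoc)
  \<comment> \<open>Substituting \<open>k = p - j\<close>: since \<open>j < p\<close>, the new index
    starts at 1.\<close>
  also have "\<dots> =
      (\<Sum>k=1..p. fps_const (fact p * x ^ (p - k) / fact (p - k)) * (fps_X ^ (p - k) * B ^ k))"
    by (rule sum.reindex_bij_witness[where i = "\<lambda>k. p - k" and j = "\<lambda>j. p - j"]) auto
  finally show ?thesis unfolding u_def .
qed

text \<open>Coefficients of the previous identity are compared without dividing by \<open>x\<close>,
  so that \<open>x = 0\<close> is covered too.\<close>

lemma trunc_deg_Bell_poly_Bernoulli:
  fixes lam x :: real and n p :: nat
  shows "x ^ p * trunc_deg_Bell_poly p n lam x =
    (\<Sum>m=0..n + p. of_nat ((n + p) choose m) / of_nat ((n + p) choose n)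
       * deg_Bernoulli p (n + p - m) lam * deg_Bell_poly m lam x)
    - (\<Sum>k=1..p. of_nat (p choose k) / of_nat ((n + k) choose n)
       * deg_Bernoulli k (n + k) lam * x ^ (p - k))"
proof -
  define u where "u = deg_exp lam - 1"
  define B where "B = fps_X / u"
  define E where "E = fps_exp x oo u"
  have "x ^ p * fps_nth (trunc_deg_Bell_gf p lam x) n =
      fps_nth (fps_const (x ^ p) * (fps_X ^ p * trunc_deg_Bell_gf p lam x)) (n + p)"
    by (simp add: fps_X_power_mult_nth)
  also have "\<dots> = fact p * fps_nth (E * B ^ p) (n + p) -
      (\<Sum>k=1..p. fact p * x ^ (p - k) / fact (p - k) *
        fps_nth (fps_X ^ (p - k) * B ^ k) (n + p))"
    unfolding trunc_deg_Bell_gf_Bernoulli E_def B_def u_def by (simp add: fps_sum_nth)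
  \<comment> \<open>As \<open>k \<le> p\<close>, removing \<open>fps_X ^ (p - k)\<close> shifts the
    index from \<open>n + p\<close> to \<open>n + k\<close>.\<close>
  also have "(\<Sum>k=1..p. fact p * x ^ (p - k) / fact (p - k) *
        fps_nth (fps_X ^ (p - k) * B ^ k) (n + p)) =
      (\<Sum>k=1..p. fact p * x ^ (p - k) / fact (p - k) * fps_nth (B ^ k) (n + k))"
    by (intro sum.cong refl) (simp add: fps_X_power_mult_nth)
  finally have coeff: "x ^ p * fps_nth (trunc_deg_Bell_gf p lam x) n =
      fact p * fps_nth (E * B ^ p) (n + p) -
      (\<Sum>k=1..p. fact p * x ^ (p - k) / fact (p - k) * fps_nth (B ^ k) (n + k))" .
  have "x ^ p * trunc_deg_Bell_poly p n lam x =
      fact n * (x ^ p * fps_nth (trunc_deg_Bell_gf p lam x) n)"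
    by (simp add: trunc_deg_Bell_poly_def)
  also have "\<dots> =
      (\<Sum>m=0..n + p. fact n * fact p * (fps_nth E m * fps_nth (B ^ p) (n + p - m))) -
      (\<Sum>k=1..p. fact n * (fact p * x ^ (p - k) / fact (p - k) * fps_nth (B ^ k) (n + k)))"
    unfolding coeff by (simp add: fps_mult_nth right_diff_distrib sum_distrib_left mult.assoc)
  \<comment> \<open>The quotient of binomials is
    \<open>fact n * fact p / (fact m * fact (n + p - m))\<close>; its denominator cancels the
    factorials in the Bell and Bernoulli values.\<close>
  also have "(\<Sum>m=0..n + p. fact n * fact p * (fps_nth E m * fps_nth (B ^ p) (n + p - m))) =
      (\<Sum>m=0..n + p. of_nat ((n + p) choose m) / of_nat ((n + p) choose n)
         * deg_Bernoulli p (n + p - m) lam * deg_Bell_poly m lam x)"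
    by (intro sum.cong refl)
      (simp add: binomial_fact deg_Bernoulli_def deg_Bell_poly_def B_def E_def u_def)
  \<comment> \<open>Here \<open>fact k\<close> cancels between the two binomials, and
    \<open>fact (n + k)\<close> against the Bernoulli number.\<close>
  also have "(\<Sum>k=1..p. fact n * (fact p * x ^ (p - k) / fact (p - k) * fps_nth (B ^ k) (n + k))) =
      (\<Sum>k=1..p. of_nat (p choose k) / of_nat ((n + k) choose n)
         * deg_Bernoulli k (n + k) lam * x ^ (p - k))"
    by (intro sum.cong refl) (simp add: binomial_fact deg_Bernoulli_def B_def u_def)
  finally show ?thesis .
qed

theorem theorem6:
  fixes lam x :: real and n p :: nat
  shows "x ^ p * trunc_deg_Bell_poly p n lam x =
           (\<Sum>m=0..n + p. of_nat ((n + p) choose m) / of_nat ((n + p) choose n)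
              * deg_Bernoulli p (n + p - m) lam * deg_Bell_poly m lam x)
           - (\<Sum>k=1..p. of_nat (p choose k) / of_nat ((n + k) choose n)
              * deg_Bernoulli k (n + k) lam * x ^ (p - k))
       \<and> trunc_deg_Bell p n lam =
           (\<Sum>m=0..n + p. of_nat ((n + p) choose m) / of_nat ((n + p) choose n)
              * deg_Bernoulli p (n + p - m) lam * deg_Bell m lam)
           - (\<Sum>k=1..p. of_nat (p choose k) / of_nat ((n + k) choose n)
              * deg_Bernoulli k (n + k) lam)"
  using trunc_deg_Bell_poly_Bernoulli[of x p n lam] trunc_deg_Bell_poly_Bernoulli[of 1 p n lam]
  by (simp add: trunc_deg_Bell_def deg_Bell_def)

end
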